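(* Let $\gamma(1)>0$. For any $0<\varepsilon\le1$ there is (for suitable finite action and percept sets) a lower semicomputable chronological contextual semimeasure $\nu$ that is not a measure and a policy $\pi$ that receives a total of $\gamma(1)$ expected discounted rewards in $\nu$, but iterative AINU receives only $\varepsilon\gamma(1)$ expected discounted rewards in $\nu$. That is, $G_\nu(\pi)=\gamma(1)$ and $G_\nu(\pi_W)=\varepsilon\gamma(1)$ for every policy $\pi_W$ that is $\nu$-optimal according to the iterative value function.
   Context: Actions and percepts range over finite sets $\mathcal{A}$ and $\mathcal{E}$; a percept is $e=(o,r)$ with reward $r\in[0,1]$ (observations may be vacuous). A history is $\ae_{<t}=a_1e_1\ldots a_{t-1}e_{t-1}$. Policies are deterministic maps from histories to actions. A chronological contextual semimeasure $\nu$ assigns to all equal-length $e_{1:t}\in\mathcal{E}^t$, $a_{1:t}\in\mathcal{A}^t$ a number $\nu(e_{1:t}\,\|\,a_{1:t})\in[0,1]$ with $\nu(\epsilon\,\|\,\epsilon)\le1$ and $\sum_{e_t\in\mathcal{E}}\nu(e_{1:t}\,\|\,a_{1:t})\le\nu(e_{<t}\,\|\,a_{<t})$; it is a measure if equality always holds, and lower semicomputable if $\{(e_{1:t},a_{1:t},q):q\in\mathbb{Q},\ \nu(e_{1:t}\,\|\,a_{1:t})>q\}$ is recursively enumerable. The discount function $\gamma:\mathbb{N}\to\mathbb{R}_{\ge0}$ is computable and summable, $\Gamma_t:=\sum_{k\ge t}\gamma(k)$. The total ($\nu$-expected discounted) reward of $\pi$ in $\nu$ is $G_\nu(\pi):=\sum_{k=1}^\infty\gamma(k)\sum_{e_{1:k}}r_k\,\nu(e_{1:k}\,\|\,a_{1:k})$,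 where $a_i:=\pi(\ae_{<i})$ for all $i$. The iterative value of $\pi$ after history $\ae_{<t}$ (with $\nu(e_{<t}\,\|\,a_{<t})>0$) is $$W^\pi_\nu(\ae_{<t}):=\frac1{\Gamma_t}\lim_{m\to\infty}\sum_{e_{t:m}}\frac{\nu(e_{1:m}\,\|\,a_{1:m})}{\nu(e_{<t}\,\|\,a_{<t})}\sum_{k=t}^m\gamma(k)r_k,\qquad a_i:=\pi(\ae_{<i})\text{ for }i\ge t,$$ if $\Gamma_t>0$ and $0$ if $\Gamma_t=0$; $W^*_\nu:=\sup_\pi W^\pi_\nu$. Iterative AINU is a policy $\pi$ with $W^\pi_\nu(\ae_{<t})=W^*_\nu(\ae_{<t})$ for all histories (at which the value is defined). *)

theory Defs
  imports Complex_Main "HOL-Library.Nat_Bijection"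
begin

section \<open>Computability\<close>

text \<open>
  Partial recursive functions. Functions take argument lists of arbitrary length and read
  missing arguments as \<open>0\<close>; on the lists of a fixed length \<open>n\<close> they are exactly the
  \<open>n\<close>-ary partial recursive functions. \<open>None\<close> stands for divergence.
\<close>

definition arg :: "nat \<Rightarrow> nat list \<Rightarrow> nat" where
  "arg i xs = (if i < length xs then xs ! i else 0)"

definition comp_rec ::
  "(nat list \<Rightarrow> nat option) \<Rightarrow> (nat list \<Rightarrow> nat option) list \<Rightarrow> nat list \<Rightarrow> nat option" where
  "comp_rec f gs xs =
     (if \<forall>g\<in>set gs. g xs \<noteq> None then f (map (\<lambda>g. the (g xs)) gs) else None)"

primrec prim_rec ::
  "(nat list \<Rightarrow> nat option) \<Rightarrow> (nat list \<Rightarrow> nat option) \<Rightarrow> nat list \<Rightarrow> nat \<Rightarrow> nat option" where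
  "prim_rec f g xs 0 = f xs"
| "prim_rec f g xs (Suc n) = Option.bind (prim_rec f g xs n) (\<lambda>r. g (n # r # xs))"

definition mu_rec :: "(nat list \<Rightarrow> nat option) \<Rightarrow> nat list \<Rightarrow> nat option" where
  "mu_rec f xs =
     (if \<exists>n. f (n # xs) = Some 0 \<and> (\<forall>m<n. f (m # xs) \<noteq> None)
      then Some (LEAST n. f (n # xs) = Some 0) else None)"

inductive partial_recursive :: "(nat list \<Rightarrow> nat option) \<Rightarrow> bool" where
  zero: "partial_recursive (\<lambda>xs. Some 0)"
| succ: "partial_recursive (\<lambda>xs. Some (Suc (arg 0 xs)))"
| proj: "partial_recursive (\<lambda>xs. Some (arg i xs))"
| comp: "partial_recursive f \<Longrightarrow> (\<forall>g\<in>set gs. partial_recursive g) \<Longrightarrow>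
         partial_recursive (comp_rec f gs)"
| prec: "partial_recursive f \<Longrightarrow> partial_recursive g \<Longrightarrow>
         partial_recursive (\<lambda>xs. prim_rec f g (tl xs) (arg 0 xs))"
| mu:   "partial_recursive f \<Longrightarrow> partial_recursive (mu_rec f)"

text \<open>Recursively enumerable \<open>n\<close>-ary relations: domains of partial recursive functions.\<close>

definition recursively_enumerable :: "nat \<Rightarrow> nat list set \<Rightarrow> bool" where
  "recursively_enumerable n R \<longleftrightarrow>
     R \<subseteq> {xs. length xs = n} \<and>
     (\<exists>f. partial_recursive f \<and> (\<forall>xs. length xs = n \<longrightarrow> (xs \<in> R \<longleftrightarrow> f xs \<noteq> None)))"

text \<open>
  The set of all \<open>(x, q)\<close> with \<open>x \<in> S\<close>, \<open>q\<close> rational and \<open>f x > q\<close> is recursively enumerable.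
  Points \<open>x\<close> are coded by \<open>n\<close> naturals, rationals by all their fractions \<open>p / d\<close> with \<open>d > 0\<close>,
  not only the reduced one.
\<close>

definition lower_semicomputable ::
  "nat \<Rightarrow> ('x \<Rightarrow> nat list) \<Rightarrow> 'x set \<Rightarrow> ('x \<Rightarrow> real) \<Rightarrow> bool" where
  "lower_semicomputable n code S f \<longleftrightarrow>
     recursively_enumerable (n + 2)
       {code x @ [int_encode p, d] | x p d. x \<in> S \<and> d > 0 \<and> f x > real_of_int p / real d}"

text \<open>A real-valued function is computable if it is lower and upper semicomputable.\<close>

definition computable_seq :: "(nat \<Rightarrow> real) \<Rightarrow> bool" where
  "computable_seq f \<longleftrightarrow>
     lower_semicomputable 1 (\<lambda>k. [k]) UNIV f \<and> lower_semicomputable 1 (\<lambda>k. [k]) UNIV (\<lambda>k. - f k)"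


section \<open>Environments\<close>

text \<open>
  Actions and observations are represented by natural numbers, which loses no generality for
  finite sets; rewards are arbitrary reals in the unit interval.
\<close>

type_synonym action = nat
type_synonym percept = "nat \<times> real"
type_synonym history = "(action \<times> percept) list"
type_synonym policy = "history \<Rightarrow> action"
type_synonym environment = "percept list \<Rightarrow> action list \<Rightarrow> real"

abbreviation reward :: "percept \<Rightarrow> real" where
  "reward \<equiv> snd"

definition action_space :: "action set \<Rightarrow> bool" where
  "action_space A \<longleftrightarrow> finite A \<and> A \<noteq> {}"

definition percept_space :: "percept set \<Rightarrow> bool" where
  "percept_space E \<longleftrightarrow> finite E \<and> E \<noteq> {} \<and> (\<forall>e\<in>E. 0 \<le> reward e \<and> reward e \<le> 1)"

definition strings :: "'x set \<Rightarrow> nat \<Rightarrow> 'x list set" where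
  "strings X n = {xs. set xs \<subseteq> X \<and> length xs = n}"

definition histories :: "action set \<Rightarrow> percept set \<Rightarrow> history set" where
  "histories A E = lists (A \<times> E)"

definition policies :: "action set \<Rightarrow> percept set \<Rightarrow> policy set" where
  "policies A E = {\<pi>. \<forall>h\<in>histories A E. \<pi> h \<in> A}"

text \<open>\<open>\<nu> es as\<close> is \<open>\<nu>(e\<^sub>1\<dots>e\<^sub>t \<parallel> a\<^sub>1\<dots>a\<^sub>t)\<close>; only its values on strings of equal length over
  \<open>E\<close> and \<open>A\<close> matter.\<close>

definition cc_semimeasure :: "action set \<Rightarrow> percept set \<Rightarrow> environment \<Rightarrow> bool" where
  "cc_semimeasure A E \<nu> \<longleftrightarrow>
     (\<forall>t. \<forall>es\<in>strings E t. \<forall>as\<in>strings A t. 0 \<le> \<nu> es as \<and> \<nu> es as \<le> 1) \<and>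
     \<nu> [] [] \<le> 1 \<and>
     (\<forall>t. \<forall>es\<in>strings E t. \<forall>as\<in>strings A t. \<forall>a\<in>A.
        (\<Sum>e\<in>E. \<nu> (es @ [e]) (as @ [a])) \<le> \<nu> es as)"

definition cc_measure :: "action set \<Rightarrow> percept set \<Rightarrow> environment \<Rightarrow> bool" where
  "cc_measure A E \<nu> \<longleftrightarrow>
     cc_semimeasure A E \<nu> \<and>
     \<nu> [] [] = 1 \<and>
     (\<forall>t. \<forall>es\<in>strings E t. \<forall>as\<in>strings A t. \<forall>a\<in>A.
        (\<Sum>e\<in>E. \<nu> (es @ [e]) (as @ [a])) = \<nu> es as)"

text \<open>
  A percept contains a real reward, so percepts enter computations through names \<open>c e\<close>. Since \<open>E\<close>
  is finite, the choice of the injective naming \<open>c\<close> is irrelevant.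
\<close>

definition lsc_environment :: "action set \<Rightarrow> percept set \<Rightarrow> environment \<Rightarrow> bool" where
  "lsc_environment A E \<nu> \<longleftrightarrow>
     (\<exists>c :: percept \<Rightarrow> nat. inj_on c E \<and>
        lower_semicomputable 2 (\<lambda>(es, as). [list_encode (map c es), list_encode as])
          (\<Union>t. strings E t \<times> strings A t) (\<lambda>(es, as). \<nu> es as))"


section \<open>Discounted reward and iterative value\<close>

text \<open>Time starts at \<open>1\<close>; \<open>\<gamma> 0\<close> is never used in a reward sum.\<close>

definition discount :: "(nat \<Rightarrow> real) \<Rightarrow> bool" where
  "discount \<gamma> \<longleftrightarrow> (\<forall>k. 0 \<le> \<gamma> k) \<and> computable_seq \<gamma> \<and> summable \<gamma>"

definition Gam :: "(nat \<Rightarrow> real) \<Rightarrow> nat \<Rightarrow> real" where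
  "Gam \<gamma> t = (\<Sum>k. \<gamma> (t + k))"

text \<open>\<open>run \<pi> h es\<close> continues \<open>h\<close> with actions chosen by \<open>\<pi>\<close> and percepts \<open>es\<close>.\<close>

fun run :: "policy \<Rightarrow> history \<Rightarrow> percept list \<Rightarrow> history" where
  "run \<pi> h [] = h"
| "run \<pi> h (e # es) = run \<pi> (h @ [(\<pi> h, e)]) es"

definition hprob :: "environment \<Rightarrow> history \<Rightarrow> real" where
  "hprob \<nu> h = \<nu> (map snd h) (map fst h)"

definition total_reward ::
  "(nat \<Rightarrow> real) \<Rightarrow> percept set \<Rightarrow> environment \<Rightarrow> policy \<Rightarrow> real" where
  "total_reward \<gamma> E \<nu> \<pi> =
     (\<Sum>i. let k = Suc i in
        \<gamma> k * (\<Sum>es\<in>strings E k. reward (last es) * hprob \<nu> (run \<pi> [] es)))"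

text \<open>
  With \<open>t = length h + 1\<close>, the strings \<open>es\<close> range over \<open>e\<^sub>t\<dots>e\<^sub>m\<close>, so \<open>es ! (k - t)\<close> is \<open>e\<^sub>k\<close>.
  The limit always exists when \<open>\<nu>\<close> is a semimeasure and \<open>\<gamma>\<close> is nonnegative and summable: by
  adding a percept the expression increases by at most \<open>\<gamma> (m + 1)\<close>.
\<close>

definition iterative_value ::
  "(nat \<Rightarrow> real) \<Rightarrow> percept set \<Rightarrow> environment \<Rightarrow> policy \<Rightarrow> history \<Rightarrow> real" where
  "iterative_value \<gamma> E \<nu> \<pi> h =
     (let t = Suc (length h) in
      if Gam \<gamma> t > 0 then
        1 / Gam \<gamma> t *
        lim (\<lambda>m. \<Sum>es\<in>strings E (Suc m - t).
               hprob \<nu> (run \<pi> h es) / hprob \<nu> h * (\<Sum>k=t..m. \<gamma> k * reward (es ! (k - t))))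
      else 0)"

definition optimal_iterative_value ::
  "(nat \<Rightarrow> real) \<Rightarrow> action set \<Rightarrow> percept set \<Rightarrow> environment \<Rightarrow> history \<Rightarrow> real" where
  "optimal_iterative_value \<gamma> A E \<nu> h = (SUP \<pi>\<in>policies A E. iterative_value \<gamma> E \<nu> \<pi> h)"

definition iterative_AINU ::
  "(nat \<Rightarrow> real) \<Rightarrow> action set \<Rightarrow> percept set \<Rightarrow> environment \<Rightarrow> policy \<Rightarrow> bool" where
  "iterative_AINU \<gamma> A E \<nu> \<pi> \<longleftrightarrow>
     \<pi> \<in> policies A E \<and>
     (\<forall>h\<in>histories A E. hprob \<nu> h > 0 \<longrightarrow>
        iterative_value \<gamma> E \<nu> \<pi> h = optimal_iterative_value \<gamma> A E \<nu> h)"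

end

theory Submission
  imports Defs
begin

text \<open>
  In the witnessing environment the first action is a choice between two deterministic worlds.
  Action \<open>0\<close> yields reward \<open>1\<close>, but no second percept is ever produced, so all probability mass is
  lost at time \<open>2\<close>. Action \<open>1\<close> yields reward \<open>\<epsilon>\<close> and then zero rewards forever. The total reward
  collects the first reward in both worlds, whereas the limit in the iterative value only counts
  rewards along percept sequences that keep their mass: it is \<open>0\<close> for action \<open>0\<close> and positive for
  action \<open>1\<close>. The environment is \<open>{0, 1}\<close>-valued and decidable on the codes of its arguments, hence
  lower semicomputable, even if \<open>\<epsilon>\<close> is not computable, since percepts are only named.
\<close>

section \<open>Total recursive functions and decidable relations\<close>

text \<open>Only lists of length \<open>n\<close> are constrained, so any HOL term may describe the
  function there, and the rules in \<open>recursive_intros\<close> can follow the syntax of that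
  term.\<close>

definition total_recursive :: "nat \<Rightarrow> (nat list \<Rightarrow> nat) \<Rightarrow> bool" where
  "total_recursive n F \<longleftrightarrow>
     (\<exists>f. partial_recursive f \<and> (\<forall>xs. length xs = n \<longrightarrow> f xs = Some (F xs)))"

abbreviation decidable :: "nat \<Rightarrow> (nat list \<Rightarrow> bool) \<Rightarrow> bool" where
  "decidable n P \<equiv> total_recursive n (\<lambda>xs. of_bool (P xs))"

lemma arg_Cons_0 [simp]: "arg 0 (x # xs) = x"
  and arg_Cons_Suc [simp]: "arg (Suc i) (x # xs) = arg i xs"
  by (simp_all add: arg_def)

lemma arg_Cons_numeral [simp]: "arg (numeral v) (x # xs) = arg (pred_numeral v) xs"
  by (simp add: numeral_eq_Suc)

lemma arg_tl [simp]: "arg i (tl xs) = arg (Suc i) xs"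
  by (cases xs) (simp_all add: arg_def)

lemma arg_drop [simp]: "arg i (drop k xs) = arg (i + k) xs"
  by (auto simp: arg_def add.commute less_diff_conv)

lemma total_recursive_cong:
  assumes "total_recursive n F" "\<And>xs. length xs = n \<Longrightarrow> F xs = G xs"
  shows "total_recursive n G"
  using assms unfolding total_recursive_def by metis

named_theorems recursive_intros

lemma total_recursive_arg [recursive_intros]: "total_recursive n (\<lambda>xs. arg i xs)"
  unfolding total_recursive_def using partial_recursive.proj by blast

lemma total_recursive_comp:
  assumes F: "total_recursive (length Gs) F" and Gs: "\<forall>G\<in>set Gs. total_recursive n G"
  shows "total_recursive n (\<lambda>xs. F (map (\<lambda>G. G xs) Gs))"
proof -
  obtain f where f: "partial_recursive f" "\<And>xs. length xs = length Gs \<Longrightarrow> f xs = Some (F xs)"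
    using F unfolding total_recursive_def by blast
  obtain g where g: "\<And>G. G \<in> set Gs \<Longrightarrow> partial_recursive (g G)"
    "\<And>G xs. G \<in> set Gs \<Longrightarrow> length xs = n \<Longrightarrow> g G xs = Some (G xs)"
    using Gs unfolding total_recursive_def by metis
  have "partial_recursive (comp_rec f (map g Gs))"
    using f(1) g(1) by (intro partial_recursive.comp) auto
  moreover have "comp_rec f (map g Gs) xs = Some (F (map (\<lambda>G. G xs) Gs))" if "length xs = n" for xs
    using f(2)[of "map (\<lambda>G. G xs) Gs"] g(2) that
    by (simp add: comp_rec_def comp_def cong: map_cong)
  ultimately show ?thesis
    unfolding total_recursive_def by blast
qed

text \<open>Reduces closure under an operation to the operation on bare arguments, where it can be
  unfolded into a recursion or a search.\<close>

lemma total_recursive_comp1: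
  assumes "total_recursive 1 (\<lambda>xs. h (arg 0 xs))" "total_recursive n F"
  shows "total_recursive n (\<lambda>xs. h (F xs))"
  using total_recursive_comp[of "[F]" "\<lambda>xs. h (arg 0 xs)" n] assms by simp

lemma total_recursive_comp2:
  assumes "total_recursive 2 (\<lambda>xs. h (arg 0 xs) (arg 1 xs))"
    and "total_recursive n F" "total_recursive n G"
  shows "total_recursive n (\<lambda>xs. h (F xs) (G xs))"
  using total_recursive_comp[of "[F, G]" "\<lambda>xs. h (arg 0 xs) (arg 1 xs)" n] assms
  by (simp add: numeral_2_eq_2)

lemma total_recursive_Suc [recursive_intros]:
  assumes "total_recursive n F"
  shows "total_recursive n (\<lambda>xs. Suc (F xs))"
proof (rule total_recursive_comp1[OF _ assms])
  show "total_recursive 1 (\<lambda>xs. Suc (arg 0 xs))"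
    unfolding total_recursive_def using partial_recursive.succ by blast
qed

lemma total_recursive_const [recursive_intros]: "total_recursive n (\<lambda>xs. c)"
proof (induction c)
  case 0
  show ?case
    unfolding total_recursive_def using partial_recursive.zero by blast
next
  case (Suc c)
  then show ?case by (rule total_recursive_Suc)
qed

text \<open>The scheme \<open>prec\<close> recurses on its first argument. Composing it with
  \<open>N\<close> followed by the \<open>n\<close> projections gives recursion up to a computed
  bound and keeps the parameters.\<close>

lemma total_recursive_rec_nat:
  assumes F: "total_recursive n F"
    and G: "total_recursive (Suc (Suc n)) (\<lambda>ys. G (arg 0 ys) (arg 1 ys) (drop 2 ys))"
    and N: "total_recursive n N"
  shows "total_recursive n (\<lambda>xs. rec_nat (F xs) (\<lambda>k r. G k r xs) (N xs))"
proof -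
  obtain f where f: "partial_recursive f" "\<And>xs. length xs = n \<Longrightarrow> f xs = Some (F xs)"
    using F unfolding total_recursive_def by blast
  obtain g where g: "partial_recursive g"
    "\<And>k r xs. length xs = n \<Longrightarrow> g (k # r # xs) = Some (G k r xs)"
    using G unfolding total_recursive_def by fastforce
  have "prim_rec f g xs k = Some (rec_nat (F xs) (\<lambda>k r. G k r xs) k)" if "length xs = n" for xs k
    by (induction k) (simp_all add: f(2) g(2) that)
  then have "total_recursive (Suc n)
      (\<lambda>xs. rec_nat (F (tl xs)) (\<lambda>k r. G k r (tl xs)) (arg 0 xs))"
    unfolding total_recursive_def using partial_recursive.prec[OF f(1) g(1)] by fastforce
  from total_recursive_comp[of "N # map (\<lambda>i xs. arg i xs) [0..<n]", simplified, OF this, of n]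
  have *: "total_recursive n (\<lambda>xs. rec_nat (F (map (\<lambda>i. arg i xs) [0..<n]))
      (\<lambda>k r. G k r (map (\<lambda>i. arg i xs) [0..<n])) (N xs))"
    using N by (simp add: comp_def total_recursive_arg)
  have "map (\<lambda>i. arg i xs) [0..<n] = xs" if "length xs = n" for xs
    using that by (intro nth_equalityI) (auto simp: arg_def)
  then show ?thesis
    by (intro total_recursive_cong[OF *]) simp
qed

section \<open>Arithmetic operations on naturals\<close>

lemma total_recursive_add [recursive_intros]:
  assumes "total_recursive n F" "total_recursive n G"
  shows "total_recursive n (\<lambda>xs. F xs + G xs)"
proof (rule total_recursive_comp2[OF _ assms])
  have *: "x + y = rec_nat x (\<lambda>k r. Suc r) y" for x y :: nat
    by (induction y) auto
  show "total_recursive 2 (\<lambda>xs. arg 0 xs + arg 1 xs)"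
    unfolding * by (intro total_recursive_rec_nat recursive_intros)
qed

lemma total_recursive_pred:
  assumes "total_recursive n F"
  shows "total_recursive n (\<lambda>xs. F xs - 1)"
proof (rule total_recursive_comp1[OF _ assms])
  have *: "x - 1 = rec_nat 0 (\<lambda>k r. k) x" for x :: nat
    by (induction x) auto
  show "total_recursive 1 (\<lambda>xs. arg 0 xs - 1)"
    unfolding * by (intro total_recursive_rec_nat recursive_intros)
qed

lemma total_recursive_diff [recursive_intros]:
  assumes "total_recursive n F" "total_recursive n G"
  shows "total_recursive n (\<lambda>xs. F xs - G xs)"
proof (rule total_recursive_comp2[OF _ assms])
  \<comment> \<open>Stated for \<open>arg\<close> terms only: a rewrite rule for arbitrary
    differences would apply again to the \<open>r - 1\<close> on its own right-hand side.\<close>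
  have *: "arg 0 xs - arg 1 xs = rec_nat (arg 0 xs) (\<lambda>k r. r - 1) (arg 1 xs)" for xs
  proof -
    have "x - y = rec_nat x (\<lambda>k r. r - 1) y" for x y :: nat
      by (induction y) auto
    then show ?thesis .
  qed
  show "total_recursive 2 (\<lambda>xs. arg 0 xs - arg 1 xs)"
    unfolding * by (intro total_recursive_rec_nat total_recursive_pred recursive_intros)
qed

section \<open>Decidable relations and unbounded search\<close>

lemma decidable_not [recursive_intros]:
  assumes "decidable n P"
  shows "decidable n (\<lambda>xs. \<not> P xs)"
proof -
  have *: "of_bool (\<not> b) = 1 - (of_bool b :: nat)" for b
    by simp
  show ?thesis
    unfolding * by (intro recursive_intros assms)
qed

text \<open>\<open>mu_rec\<close> looks for a zero, so it is given the indicator of the negation;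
  \<open>ex\<close> makes the search halt.\<close>

lemma total_recursive_Least:
  assumes P: "decidable (Suc n) (\<lambda>ys. P (arg 0 ys) (tl ys))"
    and ex: "\<And>xs. length xs = n \<Longrightarrow> \<exists>k. P k xs"
  shows "total_recursive n (\<lambda>xs. LEAST k. P k xs)"
proof -
  obtain f where f: "partial_recursive f"
    "\<And>k xs. length xs = n \<Longrightarrow> f (k # xs) = Some (of_bool (\<not> P k xs))"
    using decidable_not[OF P] unfolding total_recursive_def by fastforce
  then have "mu_rec f xs = Some (LEAST k. P k xs)" if "length xs = n" for xs
    using ex that by (simp add: mu_rec_def)
  then show ?thesis
    unfolding total_recursive_def using partial_recursive.mu[OF f(1)] by blast
qed

text \<open>An unbounded search whose test ignores the search variable: it halts at once if
  \<open>P\<close> holds and diverges otherwise.\<close>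

lemma recursively_enumerable_decidable:
  assumes P: "decidable n P"
  shows "recursively_enumerable n {xs. length xs = n \<and> P xs}"
proof -
  have "decidable (Suc n) (\<lambda>ys. \<not> P (map (\<lambda>i. arg (Suc i) ys) [0..<n]))"
    using total_recursive_comp[of "map (\<lambda>i xs. arg (Suc i) xs) [0..<n]" "\<lambda>xs. of_bool (P xs)" "Suc n"] P
    by (intro decidable_not) (simp add: comp_def total_recursive_arg)
  moreover have "map (\<lambda>i. arg i xs) [0..<n] = xs" if "length xs = n" for xs
    using that by (intro nth_equalityI) (auto simp: arg_def)
  ultimately obtain f where f: "partial_recursive f"
    "\<And>k xs. length xs = n \<Longrightarrow> f (k # xs) = Some (of_bool (\<not> P xs))"
    unfolding total_recursive_def by fastforce
  then have "mu_rec f xs \<noteq> None \<longleftrightarrow> P xs" if "length xs = n" for xs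
    using that by (simp add: mu_rec_def)
  then show ?thesis
    unfolding recursively_enumerable_def using partial_recursive.mu[OF f(1)] by blast
qed

lemma decidable_conj [recursive_intros]:
  assumes "decidable n P" "decidable n Q"
  shows "decidable n (\<lambda>xs. P xs \<and> Q xs)"
proof -
  have *: "of_bool (b \<and> c) = 1 - (of_bool (\<not> b) + of_bool (\<not> c) :: nat)" for b c
    by simp
  show ?thesis
    unfolding * by (intro recursive_intros assms)
qed

lemma decidable_disj [recursive_intros]:
  assumes "decidable n P" "decidable n Q"
  shows "decidable n (\<lambda>xs. P xs \<or> Q xs)"
proof -
  have "decidable n (\<lambda>xs. \<not> (\<not> P xs \<and> \<not> Q xs))"
    by (intro recursive_intros assms)
  then show ?thesis by simp
qed

lemma decidable_less [recursive_intros]: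
  assumes "total_recursive n F" "total_recursive n G"
  shows "decidable n (\<lambda>xs. F xs < G xs)"
proof -
  have *: "of_bool (x < y) = 1 - (1 - (y - x))" for x y :: nat
    by simp
  show ?thesis
    unfolding * by (intro recursive_intros assms)
qed

lemma decidable_eq [recursive_intros]:
  assumes "total_recursive n F" "total_recursive n G"
  shows "decidable n (\<lambda>xs. F xs = G xs)"
  \<comment> \<open>Two naturals are equal when neither is smaller, so strict comparison
    suffices.\<close>
  unfolding nat_neq_iff[THEN arg_cong[of _ _ Not], simplified] by (intro recursive_intros assms)

lemma decidable_odd [recursive_intros]:
  assumes "total_recursive n F"
  shows "decidable n (\<lambda>xs. odd (F xs))"
proof (rule total_recursive_comp1[OF _ assms])
  have *: "of_bool (odd x) = rec_nat (0::nat) (\<lambda>k r. 1 - r) x" for x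
    by (induction x) auto
  show "total_recursive 1 (\<lambda>xs. of_bool (odd (arg 0 xs)))"
    unfolding * by (intro total_recursive_rec_nat recursive_intros)
qed

text \<open>Primitive recursion carries the running truth value of the conjunction. In the premise
  this value sits at position \<open>1\<close>, which \<open>P\<close> skips.\<close>

lemma decidable_all_less:
  assumes P: "decidable (Suc (Suc n)) (\<lambda>ys. P (arg 0 ys) (drop 2 ys))"
    and N: "total_recursive n N"
  shows "decidable n (\<lambda>xs. \<forall>k<N xs. P k xs)"
proof -
  have *: "of_bool (\<forall>k<m. Q k) = rec_nat (1::nat) (\<lambda>k r. of_bool (r = 1 \<and> Q k)) m"
    for m and Q :: "nat \<Rightarrow> bool"
  proof (induction m)
    case (Suc m)
    show ?case
      by (auto simp: Suc.IH[symmetric] All_less_Suc simp del: One_nat_def)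
  qed simp
  show ?thesis
    unfolding * by (intro total_recursive_rec_nat recursive_intros assms)
qed

subsection \<open>Coded pairs and lists\<close>

lemma total_recursive_triangle [recursive_intros]:
  assumes "total_recursive n F"
  shows "total_recursive n (\<lambda>xs. triangle (F xs))"
proof (rule total_recursive_comp1[OF _ assms])
  have *: "triangle x = rec_nat 0 (\<lambda>k r. r + Suc k) x" for x
    by (induction x) auto
  show "total_recursive 1 (\<lambda>xs. triangle (arg 0 xs))"
    unfolding * by (intro total_recursive_rec_nat recursive_intros)
qed

text \<open>The index of the Cantor antidiagonal containing \<open>x\<close>, that is, the largest
  \<open>s\<close> with \<open>triangle s \<le> x\<close>, in a form that unbounded search
  computes.\<close>

definition triangle_root :: "nat \<Rightarrow> nat" where
  "triangle_root x = (LEAST s. x < triangle (Suc s))"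

lemma total_recursive_triangle_root [recursive_intros]:
  assumes "total_recursive n F"
  shows "total_recursive n (\<lambda>xs. triangle_root (F xs))"
proof (rule total_recursive_comp1[OF _ assms])
  have "\<exists>s. x < triangle (Suc s)" for x
    by (rule exI[of _ x]) simp
  then show "total_recursive 1 (\<lambda>xs. triangle_root (arg 0 xs))"
    unfolding triangle_root_def
    by (intro total_recursive_Least; (simp only: arg_tl)?) (intro recursive_intros)
qed

lemma triangle_mono: "m \<le> n \<Longrightarrow> triangle m \<le> triangle n"
  by (induction rule: dec_induct) auto

text \<open>The code is \<open>triangle (m + n) + m\<close>, and \<open>m \<le> m + n\<close> keeps
  it below \<open>triangle (Suc (m + n))\<close>.\<close>

lemma triangle_root_prod_encode: "triangle_root (prod_encode (m, n)) = m + n"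
  unfolding triangle_root_def
proof (rule Least_equality)
  fix s assume "prod_encode (m, n) < triangle (Suc s)"
  then have "\<not> Suc s \<le> m + n"
    using triangle_mono[of "Suc s" "m + n"] by (auto simp: prod_encode_def simp del: triangle_Suc)
  then show "m + n \<le> s" by simp
qed (simp add: prod_encode_def)

text \<open>Subtracting the triangular number leaves the first component, and the root is the sum of
  both. All operations involved are already known to be recursive.\<close>

lemma prod_decode_conv:
  "prod_decode x = (x - triangle (triangle_root x),
                    triangle_root x - (x - triangle (triangle_root x)))"
proof -
  obtain m n where "x = prod_encode (m, n)"
    by (metis prod_decode_inverse surj_pair)
  then show ?thesis
    by (simp add: triangle_root_prod_encode) (simp add: prod_encode_def)
qed

lemma total_recursive_prod_decode [recursive_intros]:
  assumes "total_recursive n F"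
  shows "total_recursive n (\<lambda>xs. fst (prod_decode (F xs)))"
    and "total_recursive n (\<lambda>xs. snd (prod_decode (F xs)))"
  unfolding prod_decode_conv fst_conv snd_conv by (intro recursive_intros assms)+

text \<open>Both read the empty list, coded by \<open>0\<close>, as an infinite list of zeros, because
  \<open>prod_decode 0 = (0, 0)\<close>.\<close>

definition code_hd :: "nat \<Rightarrow> nat" where
  "code_hd x = fst (prod_decode (x - 1))"

definition code_tl :: "nat \<Rightarrow> nat" where
  "code_tl x = snd (prod_decode (x - 1))"

lemma prod_decode_0 [simp]: "prod_decode 0 = (0, 0)"
  using prod_encode_inverse[of "(0, 0)"] by (simp add: prod_encode_def)

lemma code_tl_list_encode: "code_tl (list_encode l) = list_encode (tl l)"
  by (cases l) (simp_all add: code_tl_def)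

lemma code_hd_list_encode: "code_hd (list_encode l) = arg 0 l"
  by (cases l) (simp_all add: code_hd_def arg_def)

lemma funpow_code_tl: "(code_tl ^^ k) (list_encode l) = list_encode (drop k l)"
  by (induction k) (simp_all add: code_tl_list_encode drop_Suc tl_drop)

lemma total_recursive_funpow_code_tl:
  assumes "total_recursive n K" "total_recursive n F"
  shows "total_recursive n (\<lambda>xs. (code_tl ^^ K xs) (F xs))"
proof (rule total_recursive_comp2[OF _ assms])
  have *: "(code_tl ^^ k) x = rec_nat x (\<lambda>_. code_tl) k" for k x
    by (induction k) auto
  show "total_recursive 2 (\<lambda>xs. (code_tl ^^ arg 0 xs) (arg 1 xs))"
    unfolding * code_tl_def by (intro total_recursive_rec_nat recursive_intros)
qed

text \<open>Iterated tails, then a head. Past the end the iterated tail is \<open>0\<close>, whose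
  head is \<open>0\<close>, just the default of \<open>arg\<close>.\<close>

lemma total_recursive_arg_list_decode [recursive_intros]:
  assumes "total_recursive n K" "total_recursive n F"
  shows "total_recursive n (\<lambda>xs. arg (K xs) (list_decode (F xs)))"
proof -
  have *: "arg k (list_decode x) = code_hd ((code_tl ^^ k) x)" for k x
    using funpow_code_tl[of k "list_decode x"] by (simp add: code_hd_list_encode)
  show ?thesis
    unfolding * code_hd_def by (intro recursive_intros total_recursive_funpow_code_tl assms)
qed

text \<open>The length is the least number of tails that leads to \<open>0\<close>, the code of the
  empty list.\<close>

lemma total_recursive_length_list_decode [recursive_intros]:
  assumes "total_recursive n F"
  shows "total_recursive n (\<lambda>xs. length (list_decode (F xs)))"
proof (rule total_recursive_comp1[OF _ assms])
  have zero: "list_encode l = 0 \<longleftrightarrow> l = []" for l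
    by (cases l) auto
  have iff: "(code_tl ^^ k) x = 0 \<longleftrightarrow> length (list_decode x) \<le> k" for k x
    using funpow_code_tl[of k "list_decode x"] by (simp add: zero)
  then have "length (list_decode x) = (LEAST k. (code_tl ^^ k) x = 0)" for x
    by (intro Least_equality[symmetric]) auto
  moreover have "total_recursive 1 (\<lambda>xs. LEAST k. (code_tl ^^ k) (arg 0 xs) = 0)"
  proof (rule total_recursive_Least)
    show "decidable (Suc 1) (\<lambda>ys. (code_tl ^^ arg 0 ys) (arg 0 (tl ys)) = 0)"
      by (intro recursive_intros total_recursive_funpow_code_tl; simp only: arg_tl)
        (intro recursive_intros)
  qed (use iff in blast)
  ultimately show "total_recursive 1 (\<lambda>xs. length (list_decode (arg 0 xs)))"
    by simp
qed

section \<open>The environment\<close>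

text \<open>Takes observations instead of percepts, so that only naturals are involved. The first
  observation records the first action; action \<open>1\<close> alone can be followed by more
  percepts, all with observation \<open>0\<close>.\<close>

fun supported :: "nat list \<Rightarrow> nat list \<Rightarrow> bool" where
  "supported [] as \<longleftrightarrow> True"
| "supported (x # xs) [] \<longleftrightarrow> False"
| "supported (x # xs) (a # as) \<longleftrightarrow> x = Suc a \<and> (xs = [] \<or> a = 1 \<and> set xs \<subseteq> {0})"

definition trap_env :: environment where
  "trap_env es as = of_bool (supported (map fst es) as)"

text \<open>The observation keeps the percepts with rewards \<open>1\<close> and \<open>\<epsilon>\<close> distinct if \<open>\<epsilon> = 1\<close>, and it serves
  as the name of the percept in computations.\<close>

definition trap_percept :: "real \<Rightarrow> nat \<Rightarrow> percept" where
  "trap_percept \<epsilon> i = (i, if i = 0 then 0 else if i = 1 then 1 else \<epsilon>)"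

abbreviation trap_percepts :: "real \<Rightarrow> percept set" where
  "trap_percepts \<epsilon> \<equiv> trap_percept \<epsilon> ` {..<3}"

lemma fst_trap_percept [simp]: "fst (trap_percept \<epsilon> i) = i"
  by (simp add: trap_percept_def)

lemma inj_trap_percept: "inj (trap_percept \<epsilon>)"
  by (metis fst_trap_percept injI)

section \<open>The semimeasure property and the loss of mass\<close>

lemma sum_trap_percepts:
  "(\<Sum>e\<in>trap_percepts \<epsilon>. f e) =
     f (trap_percept \<epsilon> 0) + f (trap_percept \<epsilon> 1) + (f (trap_percept \<epsilon> 2) :: real)"
  by (subst sum.reindex[OF inj_on_subset[OF inj_trap_percept]])
    (simp_all add: eval_nat_numeral)

text \<open>At most one \<open>x\<close> qualifies, and only if the shorter string is supported;
  this gives the semimeasure inequality.\<close>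

lemma supported_snoc:
  "length os = length as \<Longrightarrow> supported (os @ [x]) (as @ [a]) \<longleftrightarrow>
     (if os = [] then x = Suc a else supported os as \<and> hd as = 1 \<and> x = 0)"
  by (cases "(os, as)" rule: supported.cases) auto

lemma cc_semimeasure_trap_env: "cc_semimeasure {..<2} (trap_percepts \<epsilon>) trap_env"
  by (auto simp: cc_semimeasure_def trap_env_def sum_trap_percepts supported_snoc strings_def)

text \<open>After action \<open>0\<close> and its percept the mass is \<open>1\<close>, while every
  continuation has mass \<open>0\<close>.\<close>

lemma not_cc_measure_trap_env: "\<not> cc_measure {..<2} (trap_percepts \<epsilon>) trap_env"
proof
  assume "cc_measure {..<2} (trap_percepts \<epsilon>) trap_env"
  moreover have "[trap_percept \<epsilon> 1] \<in> strings (trap_percepts \<epsilon>) 1" "[0] \<in> strings {..<2::nat} 1"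
    by (auto simp: strings_def)
  ultimately have "(\<Sum>e\<in>trap_percepts \<epsilon>. trap_env ([trap_percept \<epsilon> 1] @ [e]) ([0] @ [0])) =
      trap_env [trap_percept \<epsilon> 1] [0]"
    unfolding cc_measure_def by (meson lessThan_iff zero_less_numeral)
  then show False
    by (simp add: sum_trap_percepts trap_env_def)
qed

section \<open>Lower semicomputability of the environment\<close>

lemma supported_conv_arg:
  assumes "length os = length as"
  shows "supported os as \<longleftrightarrow> length os = 0 \<or> arg 0 os = Suc (arg 0 as) \<and>
     (length os = 1 \<or> arg 0 as = 1 \<and> (\<forall>k<length os. k = 0 \<or> arg k os = 0))"
  using assms
  by (cases "(os, as)" rule: supported.cases)
    (auto simp: subset_iff set_conv_nth arg_def All_less_Suc2)

lemma all_arg_less_iff: "(\<forall>k<length xs. arg k xs < n) \<longleftrightarrow> set xs \<subseteq> {..<n}"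
  by (auto simp: subset_iff set_conv_nth arg_def)

lemma int_encode_nonneg: "0 \<le> p \<Longrightarrow> int_encode p = 2 * nat p"
  and int_encode_neg: "p < 0 \<Longrightarrow> int_encode p = Suc (2 * nat (- p - 1))"
  by (simp_all add: int_encode_def sum_encode_def)

text \<open>Odd codes belong to negative numerators, whose fractions lie below both truth values. A
  nonnegative \<open>p\<close> has code \<open>2 * p\<close>, and its fraction is below
  \<open>1\<close> iff \<open>2 * p < d + d\<close>; it is never below \<open>0\<close>.\<close>

lemma of_bool_gt_fraction_iff:
  assumes "d > 0"
  shows "of_bool b > real_of_int p / real d \<longleftrightarrow>
    odd (int_encode p) \<or> int_encode p < d + d \<and> b"
proof (cases "p < 0")
  case True
  then have "real_of_int p / real d < 0"
    using assms by (simp add: field_simps)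
  then have "real_of_int p / real d < of_bool b"
    by (rule less_le_trans) simp
  then show ?thesis
    using True by (simp add: int_encode_neg)
next
  case False
  then obtain k where "p = int k"
    by (metis int_nat_eq not_less)
  then show ?thesis
    using assms by (cases b) (auto simp: int_encode_nonneg not_less divide_less_eq)
qed

lemma lsc_environment_trap_env: "lsc_environment {..<2} (trap_percepts \<epsilon>) trap_env"
proof -
  let ?E = "trap_percepts \<epsilon>" and ?A = "{..<2} :: nat set"
  \<comment> \<open>Built only from arithmetic, parity, list entries, lengths and bounded
    quantifiers, so that the closure rules decide it. Here \<open>p\<close> is the code of the
    numerator.\<close>
  define valid where "valid os as p d \<longleftrightarrow>
    length os = length as \<and> (\<forall>k<length os. arg k os < 3) \<and> (\<forall>k<length as. arg k as < 2) \<and>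
    0 < d \<and> (odd p \<or> p < d + d \<and> (length os = 0 \<or> arg 0 os = Suc (arg 0 as) \<and>
     (length os = 1 \<or> arg 0 as = 1 \<and> (\<forall>k<length os. k = 0 \<or> arg k os = 0))))"
    for os as :: "nat list" and p d :: nat
  let ?R = "{(case x of (es, as) \<Rightarrow> [list_encode (map fst es), list_encode as]) @ [int_encode p, d] | x p d.
      x \<in> (\<Union>t. strings ?E t \<times> strings ?A t) \<and> d > 0 \<and>
      (case x of (es, as) \<Rightarrow> trap_env es as) > real_of_int p / real d}"
  have valid_iff: "valid os as (int_encode p) d \<longleftrightarrow>
      length os = length as \<and> set os \<subseteq> {..<3} \<and> set as \<subseteq> {..<2} \<and> 0 < d \<and>
      of_bool (supported os as) > real_of_int p / real d" for os as p d
  proof (cases "length os = length as \<and> 0 < d")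
    case True
    then show ?thesis
      unfolding valid_def all_arg_less_iff supported_conv_arg[OF conjunct1[OF True], symmetric]
        of_bool_gt_fraction_iff[OF conjunct2[OF True]]
      by blast
  qed (auto simp: valid_def)
  have R: "?R = {xs. length xs = 4 \<and>
      valid (list_decode (arg 0 xs)) (list_decode (arg 1 xs)) (arg 2 xs) (arg 3 xs)}" (is "_ = ?V")
  proof (intro equalityI subsetI)
    fix xs assume "xs \<in> ?R"
    moreover have "fst ` set es \<subseteq> {..<3}" if "set es \<subseteq> ?E" for es
      using image_mono[OF that, of fst] by (simp add: image_image)
    ultimately show "xs \<in> ?V"
      by (clarsimp simp: strings_def trap_env_def valid_iff)
  next
    fix xs assume xs: "xs \<in> ?V"
    then obtain a b q d where abqd: "xs = [a, b, q, d]"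
      by (auto simp: eval_nat_numeral length_Suc_conv)
    \<comment> \<open>Every natural codes a list and an integer, so decoding always succeeds;
      \<open>trap_percept\<close> restores the rewards from the observations.\<close>
    let ?es = "map (trap_percept \<epsilon>) (list_decode a)" and ?as = "list_decode b"
    have "valid (list_decode a) ?as (int_encode (int_decode q)) d"
      using xs by (simp add: abqd)
    then have "(?es, ?as) \<in> (\<Union>t. strings ?E t \<times> strings ?A t)" "d > 0"
      "trap_env ?es ?as > real_of_int (int_decode q) / real d"
      unfolding valid_iff by (auto simp: strings_def trap_env_def comp_def)
    moreover have "xs = [list_encode (map fst ?es), list_encode ?as] @ [int_encode (int_decode q), d]"
      by (simp add: abqd comp_def)
    ultimately show "xs \<in> ?R"
      by (intro CollectI exI[of _ "(?es, ?as)"] exI[of _ "int_decode q"] exI[of _ d]) simp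
  qed
  have "decidable 4 (\<lambda>xs. valid (list_decode (arg 0 xs)) (list_decode (arg 1 xs)) (arg 2 xs) (arg 3 xs))"
    unfolding valid_def
    by (intro recursive_intros decidable_all_less; simp only: arg_drop; intro recursive_intros)
  then have "recursively_enumerable 4 ?R"
    unfolding R by (rule recursively_enumerable_decidable)
  moreover have "inj_on fst ?E"
    by (auto simp: inj_on_def)
  ultimately show ?thesis
    unfolding lsc_environment_def lower_semicomputable_def
    by (intro exI[of _ fst]) simp
qed

section \<open>Values of the policies\<close>

lemma map_snd_run: "map snd (run \<pi> h es) = map snd h @ es"
  by (induction es arbitrary: h) auto

lemma run_Cons: "\<exists>h'. run \<pi> (x # h) es = x # h'"
  by (induction es arbitrary: h) auto

lemma finite_strings: "finite E \<Longrightarrow> finite (strings E n)"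
  unfolding strings_def by (rule finite_lists_length_eq)

text \<open>The only percept string of length \<open>Suc n\<close> that can carry mass when the
  first action is \<open>a\<close>.\<close>

definition trap_path :: "real \<Rightarrow> nat \<Rightarrow> nat \<Rightarrow> percept list" where
  "trap_path \<epsilon> a n = trap_percept \<epsilon> (Suc a) # replicate n (trap_percept \<epsilon> 0)"

lemma hprob_trap_env_run:
  assumes "es \<in> strings (trap_percepts \<epsilon>) (Suc n)"
  shows "hprob trap_env (run \<pi> [] es) = of_bool (es = trap_path \<epsilon> (\<pi> []) n \<and> (n = 0 \<or> \<pi> [] = 1))"
proof -
  obtain e fs where es: "es = e # fs" "length fs = n" "e \<in> trap_percepts \<epsilon>" "set fs \<subseteq> trap_percepts \<epsilon>"
    using assms by (auto simp: strings_def length_Suc_conv)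
  obtain h where h: "run \<pi> [] es = (\<pi> [], e) # h"
    using run_Cons[of \<pi> "(\<pi> [], e)" "[]" fs] es(1) by auto
  \<comment> \<open>A percept is determined by its observation, so conditions on observations pin
    down the whole string.\<close>
  have percept: "x = trap_percept \<epsilon> i \<longleftrightarrow> fst x = i" if "x \<in> trap_percepts \<epsilon>" for x i
    using that by auto
  have "fs = replicate n (trap_percept \<epsilon> 0) \<longleftrightarrow> fst ` set fs \<subseteq> {0}"
  proof
    assume "fst ` set fs \<subseteq> {0}"
    then show "fs = replicate n (trap_percept \<epsilon> 0)"
      using es(4) percept[of _ 0] by (intro replicate_eqI es(2)) blast
  qed (auto split: if_splits)
  moreover have "fs = [] \<longleftrightarrow> n = 0"
    using es(2) by auto
  moreover have "hprob trap_env (run \<pi> [] es) = trap_env es (\<pi> [] # map fst h)"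
    using map_snd_run[of \<pi> "[]" es] h by (simp add: hprob_def)
  ultimately show ?thesis
    using percept[OF es(3), of "Suc (\<pi> [])"] by (auto simp: es(1) trap_env_def trap_path_def)
qed

text \<open>Only one string carries mass. Leaving \<open>f\<close> arbitrary covers both the last
  reward and the discounted reward sum.\<close>

lemma sum_hprob_trap_env_run:
  assumes "\<pi> [] < 2"
  shows "(\<Sum>es\<in>strings (trap_percepts \<epsilon>) (Suc n). hprob trap_env (run \<pi> [] es) * f es) =
    of_bool (n = 0 \<or> \<pi> [] = 1) * f (trap_path \<epsilon> (\<pi> []) n)"
proof -
  let ?S = "strings (trap_percepts \<epsilon>) (Suc n)"
  have "(\<Sum>es\<in>?S. hprob trap_env (run \<pi> [] es) * f es) =
      (\<Sum>es\<in>?S. if es = trap_path \<epsilon> (\<pi> []) n then of_bool (n = 0 \<or> \<pi> [] = 1) * f es else 0)"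
    by (intro sum.cong) (auto simp: hprob_trap_env_run)
  moreover have "trap_path \<epsilon> (\<pi> []) n \<in> ?S"
    using assms by (auto simp: trap_path_def strings_def)
  ultimately show ?thesis
    by (simp add: sum.delta' finite_strings)
qed

section \<open>Total reward and iterative value of a policy\<close>

lemma reward_trap_percept_0 [simp]: "reward (trap_percept \<epsilon> 0) = 0"
  by (simp add: trap_percept_def)

text \<open>From time \<open>2\<close> on, the path either has no mass or ends with reward
  \<open>0\<close>, so only the first term of the series remains.\<close>

lemma total_reward_trap_env:
  assumes "\<pi> [] < 2"
  shows "total_reward \<gamma> (trap_percepts \<epsilon>) trap_env \<pi> = \<gamma> 1 * reward (trap_percept \<epsilon> (Suc (\<pi> [])))"
proof -
  have "(\<Sum>es\<in>strings (trap_percepts \<epsilon>) (Suc i). reward (last es) * hprob trap_env (run \<pi> [] es)) =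
      of_bool (i = 0) * reward (trap_percept \<epsilon> (Suc (\<pi> [])))" for i
    using sum_hprob_trap_env_run[where f = "\<lambda>es. reward (last es)" and \<pi> = \<pi> and \<epsilon> = \<epsilon> and n = i, OF assms]
    by (simp add: mult.commute trap_path_def)
  then have "total_reward \<gamma> (trap_percepts \<epsilon>) trap_env \<pi> =
      (\<Sum>i. \<gamma> (Suc i) * (of_bool (i = 0) * reward (trap_percept \<epsilon> (Suc (\<pi> [])))))"
    by (simp add: total_reward_def Let_def)
  also have "\<dots> = (\<Sum>i\<in>{0}. \<gamma> (Suc i) * (of_bool (i = 0) * reward (trap_percept \<epsilon> (Suc (\<pi> [])))))"
    by (rule suminf_finite) auto
  finally show ?thesis by simp
qed

text \<open>The first reward is weighted by the mass of the whole string up to \<open>m\<close>, so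
  it is forgotten once that mass is gone.\<close>

lemma iterative_value_trap_env:
  assumes "\<pi> [] < 2" and "Gam \<gamma> 1 > 0"
  shows "iterative_value \<gamma> (trap_percepts \<epsilon>) trap_env \<pi> [] = of_bool (\<pi> [] = 1) * (\<epsilon> * \<gamma> 1 / Gam \<gamma> 1)"
proof -
  define X where "X m = (\<Sum>es\<in>strings (trap_percepts \<epsilon>) m.
    hprob trap_env (run \<pi> [] es) * (\<Sum>k=1..m. \<gamma> k * reward (es ! (k - 1))))" for m
  have path: "(\<Sum>k=1..Suc n. \<gamma> k * reward (trap_path \<epsilon> 1 n ! (k - 1))) = \<epsilon> * \<gamma> 1" for n
  proof -
    have "(\<Sum>k=1..Suc n. \<gamma> k * reward (trap_path \<epsilon> 1 n ! (k - 1))) =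
        (\<Sum>k=1..Suc n. if k = 1 then \<epsilon> * \<gamma> 1 else 0)"
      by (intro sum.cong) (auto simp: trap_path_def nth_Cons' trap_percept_def)
    then show ?thesis by simp
  qed
  \<comment> \<open>At \<open>m = 1\<close> action \<open>0\<close> still has its mass; from
    \<open>m = 2\<close> on the sequence is constant.\<close>
  have "X m = of_bool (\<pi> [] = 1) * (\<epsilon> * \<gamma> 1)" if m: "m \<ge> 2" for m
  proof -
    obtain n where n: "m = Suc n" "n \<noteq> 0"
      using m by (cases m) auto
    show ?thesis
      unfolding X_def n(1) sum_hprob_trap_env_run[of \<pi>, OF assms(1)] using n(2) path by auto
  qed
  then have "lim X = of_bool (\<pi> [] = 1) * (\<epsilon> * \<gamma> 1)"
    by (intro limI tendsto_eventually eventually_sequentiallyI[of 2])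
  moreover have "hprob trap_env [] = 1"
    by (simp add: hprob_def trap_env_def)
  ultimately show ?thesis
    using assms(2) by (simp add: iterative_value_def X_def[abs_def])
qed

theorem proposition6p19:
  fixes \<gamma> :: "nat \<Rightarrow> real" and \<epsilon> :: real
  assumes "discount \<gamma>" and "\<gamma> 1 > 0" and "0 < \<epsilon>" and "\<epsilon> \<le> 1"
  shows "\<exists>A E \<nu>.
           action_space A \<and> percept_space E \<and>
           cc_semimeasure A E \<nu> \<and> lsc_environment A E \<nu> \<and> \<not> cc_measure A E \<nu> \<and>
           (\<exists>\<pi>\<in>policies A E. total_reward \<gamma> E \<nu> \<pi> = \<gamma> 1) \<and>
           (\<forall>\<pi>\<^sub>W. iterative_AINU \<gamma> A E \<nu> \<pi>\<^sub>W \<longrightarrow> total_reward \<gamma> E \<nu> \<pi>\<^sub>W = \<epsilon> * \<gamma> 1)"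
proof -
  let ?A = "{..<2} :: nat set" and ?E = "trap_percepts \<epsilon>"
  let ?W = "\<lambda>\<pi>. iterative_value \<gamma> ?E trap_env \<pi> []"
  define w where "w = \<epsilon> * \<gamma> 1 / Gam \<gamma> 1"
  have nil: "[] \<in> histories ?A ?E"
    by (simp add: histories_def)
  then have first: "\<pi> [] < 2" if "\<pi> \<in> policies ?A ?E" for \<pi>
    using that by (auto simp: policies_def)
  have const: "(\<lambda>_. a) \<in> policies ?A ?E" if "a < 2" for a
    using that by (simp add: policies_def)
  have "summable (\<lambda>k. \<gamma> (1 + k))" "\<And>k. 0 \<le> \<gamma> k"
    using assms(1) summable_ignore_initial_segment[of \<gamma> 1] by (auto simp: discount_def)
  \<comment> \<open>The positive term is the one with index \<open>0\<close> of the shifted series,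
    namely \<open>\<gamma> 1\<close>.\<close>
  then have Gam: "Gam \<gamma> 1 > 0"
    unfolding Gam_def using assms(2) by (intro suminf_pos2[of _ 0]) auto
  then have w: "w > 0"
    using assms by (simp add: w_def)
  have val: "?W \<pi> = of_bool (\<pi> [] = 1) * w" if "\<pi> \<in> policies ?A ?E" for \<pi>
    using iterative_value_trap_env[of \<pi>, OF first[OF that] Gam] by (simp add: w_def)
  \<comment> \<open>The supremum of reals dominates its members only for a bounded set.\<close>
  have "bdd_above (?W ` policies ?A ?E)"
    using w by (intro bdd_aboveI2[of _ _ w]) (simp add: val)
  then have "?W (\<lambda>_. 1) \<le> optimal_iterative_value \<gamma> ?A ?E trap_env []"
    unfolding optimal_iterative_value_def by (intro cSUP_upper const) simp_all
  then have opt: "optimal_iterative_value \<gamma> ?A ?E trap_env [] > 0"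
    using w by (simp add: val const)
  \<comment> \<open>Optimality is used at the empty history: the optimum there is positive, which
    forces the first action \<open>1\<close>.\<close>
  have "total_reward \<gamma> ?E trap_env \<pi> = \<epsilon> * \<gamma> 1" if "iterative_AINU \<gamma> ?A ?E trap_env \<pi>" for \<pi>
  proof -
    have \<pi>: "\<pi> \<in> policies ?A ?E" and "?W \<pi> > 0"
      using that nil opt by (auto simp: iterative_AINU_def hprob_def trap_env_def)
    then have "\<pi> [] = 1"
      by (cases "\<pi> [] = 1") (simp_all add: val)
    then show ?thesis
      using total_reward_trap_env[of \<pi>, OF first[OF \<pi>]] by (simp add: trap_percept_def)
  qed
  moreover have "total_reward \<gamma> ?E trap_env (\<lambda>_. 0) = \<gamma> 1"
    using total_reward_trap_env[of "\<lambda>_. 0" \<gamma> \<epsilon>] by (simp add: trap_percept_def)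
  moreover have "action_space ?A"
    by (simp add: action_space_def lessThan_empty_iff)
  moreover have "percept_space ?E"
    using assms by (auto simp: percept_space_def trap_percept_def lessThan_empty_iff)
  ultimately show ?thesis
    using cc_semimeasure_trap_env lsc_environment_trap_env not_cc_measure_trap_env const[of 0]
    by (intro exI[of _ ?A] exI[of _ ?E] exI[of _ trap_env]) auto
qed

end
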